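(* Let $\nu\ge 2$. The map $\mathcal{D}$ sending a Lehmer codeword $\langle p_i\rangle_{0\le i<\nu}$ of size $\nu$ to its first derivative $\langle p'_i\rangle_{0\le i<\nu}=\mathcal{D}(\langle p_i\rangle)$ is a bijection from the set of Lehmer codewords of size $\nu$ to itself. Its inverse $\mathcal{D}^{-1}$ is given by the following recurrence: set $p^*_0=p'_0$; for $i=0,\dots,\nu-3$, $$p_i=p^*_i+p'_{i+1}+1 \bmod (\nu-i),\qquad p^*_{i+1}=p_i+p'_{i+1}\bmod (\nu-i-1);$$ and finally $p_{\nu-2}=p^*_{\nu-2}$ and $p_{\nu-1}=0$.
   Context: A Lehmer codeword of size $\nu$ is a sequence $\langle p_i\rangle_{0\le i<\nu}$ of integers with $0\le p_i<\nu-i$ (so $p_{\nu-1}=0$); such codewords correspond bijectively to permutations of $\{0,\dots,\nu-1\}$. In all formulas "$x \bmod m$" applies to the entire expression preceding it and denotes its least nonnegative residue in $\{0,\dots,m-1\}$. The first derivative $\langle p'_i\rangle_{0\le i<\nu}$ of the codeword $\langle p_i\rangle$ is defined, with auxiliary values $p^*_i$, by $$p'_{\nu-1}=p_{\nu-1}=0,\qquad p^*_{\nu-2}=p_{\nu-2};$$ for $i=2,\dots,\nu-1$ (in increasing order), $$p'_{\nu-i}=p^*_{\nu-i}-p_{\nu-i-1}\bmod i,\qquad p^*_{\nu-i-1}=p_{\nu-i-1}-p'_{\nu-i}-1\bmod (i+1);$$ and finally $p'_0=p^*_0$. *)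

theory Defs
  imports Main
begin

text \<open>
  Codewords are integer lists. The operation \<open>mod\<close> on \<^typ>\<open>int\<close> yields the least nonnegative
  residue for a positive modulus, and all moduli below are positive wherever they are used.
\<close>

definition lehmer_codewords :: "nat \<Rightarrow> int list set" where
  "lehmer_codewords \<nu> =
     {p. length p = \<nu> \<and> (\<forall>i<\<nu>. 0 \<le> p ! i \<and> p ! i < int \<nu> - int i)}"

text \<open>
  With \<open>\<nu> = length p\<close>, \<open>deriv_star p j\<close> is $p^*_j$ (meaningful for \<open>j \<le> \<nu> - 2\<close>) and
  \<open>deriv_entry p j\<close> is $p'_j$. The recurrence is usually indexed by the distance \<open>i = \<nu> - j\<close> from
  the end: $p'_{\nu-i} = p^*_{\nu-i} - p_{\nu-i-1} \bmod i$ is the equation for \<open>deriv_entry\<close> at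
  \<open>j = \<nu> - i\<close>, and $p^*_{\nu-i-1} = p_{\nu-i-1} - p'_{\nu-i} - 1 \bmod (i+1)$ is the equation for
  \<open>deriv_star\<close> at \<open>j = \<nu> - i - 1\<close>, with \<open>i\<close> ranging over \<open>2, \<dots>, \<nu> - 1\<close>.
\<close>

function deriv_star :: "int list \<Rightarrow> nat \<Rightarrow> int"
  and deriv_entry :: "int list \<Rightarrow> nat \<Rightarrow> int" where
  "deriv_star p j =
     (if j + 2 < length p
      then (p ! j - deriv_entry p (j + 1) - 1) mod (int (length p) - int j)
      else p ! j)"
| "deriv_entry p j =
     (if j + 1 < length p
      then (if j = 0 then deriv_star p 0
            else (deriv_star p j - p ! (j - 1)) mod (int (length p) - int j))
      else 0)"
  by pat_completeness auto
termination
  by (relation "measure (case_sum (\<lambda>(p, j). 2 * (length p - j)) (\<lambda>(p, j). 2 * (length p - j) + 1))")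
    auto

text \<open>The unconditional equations would make the simplifier unfold the recursion eagerly.\<close>

declare deriv_star.simps [simp del] deriv_entry.simps [simp del]

definition first_derivative :: "int list \<Rightarrow> int list" where
  "first_derivative p = map (deriv_entry p) [0..<length p]"

text \<open>
  Here \<open>q\<close> plays the role of $p'$; \<open>antideriv_star q i\<close> is $p^*_i$ (meaningful for
  \<open>i \<le> length q - 2\<close>) and \<open>antideriv_entry q i\<close> is $p_i$.
\<close>

function antideriv_star :: "int list \<Rightarrow> nat \<Rightarrow> int"
  and antideriv_entry :: "int list \<Rightarrow> nat \<Rightarrow> int" where
  "antideriv_star q 0 = q ! 0"
| "antideriv_star q (Suc i) =
     (antideriv_entry q i + q ! (i + 1)) mod (int (length q) - int i - 1)"
| "antideriv_entry q i =
     (if i + 2 < length q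
      then (antideriv_star q i + q ! (i + 1) + 1) mod (int (length q) - int i)
      else if i + 2 = length q then antideriv_star q i
      else 0)"
  by pat_completeness auto
termination
  by (relation "measure (case_sum (\<lambda>(q, i). 2 * i) (\<lambda>(q, i). 2 * i + 1))") auto

declare antideriv_star.simps [simp del] antideriv_entry.simps [simp del]

definition antiderivative :: "int list \<Rightarrow> int list" where
  "antiderivative q = map (antideriv_entry q) [0..<length q]"

end

theory Submission imports Defs begin

text \<open>
  For $j \le \nu - 3$ the two equations
  $p^*_j = p_j - p'_{j+1} - 1 \bmod (\nu-j)$ and $p'_{j+1} = p^*_{j+1} - p_j \bmod (\nu-j-1)$
  are solvable, within the range of residues, for $p_j$ and $p^*_{j+1}$ respectively, and the
  solutions are the equations of the inverse recurrence. Both recurrences thus describe the same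
  system, with the same auxiliary values $p^*_j$; one runs through it from the right, the other
  from the left.
\<close>

lemma length_first_derivative [simp]: "length (first_derivative p) = length p"
  by (simp add: first_derivative_def)

lemma nth_first_derivative [simp]:
  "j < length p \<Longrightarrow> first_derivative p ! j = deriv_entry p j"
  by (simp add: first_derivative_def)

lemma length_antiderivative [simp]: "length (antiderivative q) = length q"
  by (simp add: antiderivative_def)

lemma nth_antiderivative [simp]:
  "i < length q \<Longrightarrow> antiderivative q ! i = antideriv_entry q i"
  by (simp add: antiderivative_def)

lemma lehmer_codewordsD:
  assumes "p \<in> lehmer_codewords \<nu>"
  shows "length p = \<nu>" and "i < \<nu> \<Longrightarrow> 0 \<le> p ! i" and "i < \<nu> \<Longrightarrow> p ! i < int \<nu> - int i"
  using assms by (auto simp: lehmer_codewords_def)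

text \<open>An \<open>a\<close> that lies between 0 and \<open>m - 1\<close> is its own residue, so
  the outer \<open>mod\<close> restores it. With \<open>a\<close> an entry of \<open>p\<close> or a
  value of \<open>deriv_star\<close>, this undoes one equation of the derivative.\<close>

lemma mod_diff_add_cancel:
  fixes a c m :: int
  assumes "0 \<le> a" "a < m"
  shows "((a - c) mod m + c) mod m = a"
  using assms by (simp add: mod_simps)

lemma mod_add_diff_cancel:
  fixes a c m :: int
  assumes "0 \<le> a" "a < m"
  shows "((a + c) mod m - c) mod m = a"
  using assms by (simp add: mod_simps)

text \<open>Residues are in range automatically; the unreduced values at the right end are entries
  of the codeword itself.\<close>

lemma deriv_star_bounds:
  assumes "p \<in> lehmer_codewords \<nu>" "j < \<nu>"
  shows "0 \<le> deriv_star p j" and "deriv_star p j < int \<nu> - int j"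
  using assms lehmer_codewordsD[OF assms(1)] by (auto simp: deriv_star.simps)

lemma antideriv_star_bounds:
  assumes "q \<in> lehmer_codewords \<nu>" "i < \<nu>"
  shows "0 \<le> antideriv_star q i" and "antideriv_star q i < int \<nu> - int i"
proof -
  have "0 \<le> antideriv_star q i \<and> antideriv_star q i < int \<nu> - int i"
  proof (cases i)
    case 0
    with assms lehmer_codewordsD(2,3)[OF assms(1), of 0] show ?thesis
      by (simp add: antideriv_star.simps)
  next
    case (Suc k)
    have "antideriv_star q i = (antideriv_entry q k + q ! (k + 1)) mod (int \<nu> - int i)"
      using lehmer_codewordsD(1)[OF assms(1)] Suc by (simp add: antideriv_star.simps algebra_simps)
    with assms(2) show ?thesis by simp
  qed
  then show "0 \<le> antideriv_star q i" and "antideriv_star q i < int \<nu> - int i" by auto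
qed

text \<open>The only entry that can be nonzero without being a residue is the one at index 0, a copy
  of \<open>deriv_star p 0\<close>.\<close>

lemma first_derivative_in_lehmer_codewords:
  assumes "p \<in> lehmer_codewords \<nu>"
  shows "first_derivative p \<in> lehmer_codewords \<nu>"
  using lehmer_codewordsD(1)[OF assms] deriv_star_bounds[OF assms, of 0]
  by (auto simp: lehmer_codewords_def deriv_entry.simps)

text \<open>Here the unreduced entry is the one at index \<open>\<nu> - 2\<close>, a copy of the
  starred value there.\<close>

lemma antiderivative_in_lehmer_codewords:
  assumes "q \<in> lehmer_codewords \<nu>"
  shows "antiderivative q \<in> lehmer_codewords \<nu>"
  using lehmer_codewordsD(1)[OF assms] antideriv_star_bounds[OF assms]
  by (auto simp: lehmer_codewords_def antideriv_entry.simps)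

text \<open>Agreement of the starred values spreads from left to right: at index \<open>i\<close> it
  yields \<open>p ! i\<close> by \<open>entry\<close>, and this in turn yields agreement at
  \<open>i + 1\<close>.\<close>

lemma antiderivative_first_derivative:
  assumes p: "p \<in> lehmer_codewords \<nu>"
  shows "antiderivative (first_derivative p) = p"
proof -
  define q where "q = first_derivative p"
  have len: "length p = \<nu>" "length q = \<nu>"
    using lehmer_codewordsD(1)[OF p] by (simp_all add: q_def)
  have q_nth: "q ! j = deriv_entry p j" if "j < \<nu>" for j
    using that len by (simp add: q_def)
  have entry: "antideriv_entry q i = p ! i"
    if star: "antideriv_star q i = deriv_star p i" and i: "i + 2 \<le> \<nu>" for i
  proof (cases "i + 2 = \<nu>")
    case True
    then show ?thesis
      using star len by (simp add: antideriv_entry.simps deriv_star.simps)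
  next
    case False
    \<comment> \<open>The summand 1 is grouped with \<open>deriv_entry p (i + 1)\<close>, so that
      the same quantity is subtracted and added back.\<close>
    then have "antideriv_entry q i
        = ((p ! i - (deriv_entry p (i + 1) + 1)) mod (int \<nu> - int i)
            + (deriv_entry p (i + 1) + 1)) mod (int \<nu> - int i)"
      using i star len q_nth
      by (simp add: antideriv_entry.simps[of q] deriv_star.simps[of p i] algebra_simps)
    also have "\<dots> = p ! i"
      using lehmer_codewordsD[OF p] i by (intro mod_diff_add_cancel) auto
    finally show ?thesis .
  qed
  have star: "antideriv_star q i = deriv_star p i" if "i + 2 \<le> \<nu>" for i
    using that
  proof (induction i)
    case 0
    then show ?case
      using len q_nth by (simp add: antideriv_star.simps deriv_entry.simps)
  next
    case (Suc i)
    then have "antideriv_entry q i = p ! i"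
      by (intro entry) auto
    then have "antideriv_star q (Suc i)
        = ((deriv_star p (Suc i) - p ! i) mod (int \<nu> - int (Suc i)) + p ! i)
            mod (int \<nu> - int (Suc i))"
      using Suc.prems len q_nth
      by (simp add: antideriv_star.simps(2) deriv_entry.simps[of p "Suc i"] algebra_simps)
    also have "\<dots> = deriv_star p (Suc i)"
      using deriv_star_bounds[OF p, of "Suc i"] Suc.prems by (intro mod_diff_add_cancel) auto
    finally show ?case .
  qed
  have "antiderivative q = p"
  proof (rule nth_equalityI)
    fix i assume "i < length (antiderivative q)"
    then have i: "i < \<nu>" using len by simp
    show "antiderivative q ! i = p ! i"
    proof (cases "i + 2 \<le> \<nu>")
      case True
      then show ?thesis using entry star i len by simp
    next
      case False
      \<comment> \<open>Only \<open>i = \<nu> - 1\<close> is left, where the codeword bounds force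
        \<open>p ! i = 0\<close>, the default value of \<open>antideriv_entry\<close>.\<close>
      then show ?thesis
        using lehmer_codewordsD(2,3)[OF p, of i] i len by (simp add: antideriv_entry.simps)
    qed
  qed (simp add: len)
  then show ?thesis by (simp add: q_def)
qed

text \<open>Now agreement spreads from right to left, starting at index \<open>\<nu> - 2\<close>,
  where both starred values are the entry of \<open>p\<close>: at \<open>j + 1\<close> it yields
  \<open>q ! (j + 1)\<close> by \<open>entry\<close>, hence agreement at \<open>j\<close>.\<close>

lemma first_derivative_antiderivative:
  assumes q: "q \<in> lehmer_codewords \<nu>" and "\<nu> \<ge> 2"
  shows "first_derivative (antiderivative q) = q"
proof -
  define p where "p = antiderivative q"
  have len: "length q = \<nu>" "length p = \<nu>"
    using lehmer_codewordsD(1)[OF q] by (simp_all add: p_def)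
  have p_nth: "p ! i = antideriv_entry q i" if "i < \<nu>" for i
    using that len by (simp add: p_def)
  have entry: "deriv_entry p (Suc j) = q ! Suc j"
    if star: "deriv_star p (Suc j) = antideriv_star q (Suc j)" and j: "j + 3 \<le> \<nu>" for j
  proof -
    have "deriv_entry p (Suc j)
        = ((q ! Suc j + antideriv_entry q j) mod (int \<nu> - int (Suc j)) - antideriv_entry q j)
            mod (int \<nu> - int (Suc j))"
      using j star len p_nth
      by (simp add: deriv_entry.simps[of p "Suc j"] antideriv_star.simps(2) algebra_simps)
    also have "\<dots> = q ! Suc j"
      using lehmer_codewordsD(2,3)[OF q, of "Suc j"] j by (intro mod_add_diff_cancel) auto
    finally show ?thesis .
  qed
  have star: "deriv_star p j = antideriv_star q j" if "j \<le> \<nu> - 2" for j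
    using that
  proof (induction rule: inc_induct)
    case base
    have "Suc (Suc (\<nu> - 2)) = \<nu>"
      using \<open>\<nu> \<ge> 2\<close> by simp
    then show ?case
      using \<open>\<nu> \<ge> 2\<close> len p_nth by (simp add: deriv_star.simps antideriv_entry.simps)
  next
    case (step j)
    then have "deriv_entry p (Suc j) = q ! Suc j"
      by (intro entry) auto
    \<comment> \<open>Strictness selects the reduced branch in both definitions.\<close>
    moreover have "Suc (Suc j) < \<nu>"
      using step.hyps by simp
    ultimately have "deriv_star p j
        = ((antideriv_star q j + (q ! Suc j + 1)) mod (int \<nu> - int j) - (q ! Suc j + 1))
            mod (int \<nu> - int j)"
      using len p_nth
      by (simp add: deriv_star.simps[of p j] antideriv_entry.simps[of q j] algebra_simps)
    also have "\<dots> = antideriv_star q j"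
      using antideriv_star_bounds[OF q] step.hyps by (intro mod_add_diff_cancel) auto
    finally show ?case .
  qed
  have "first_derivative p = q"
  proof (rule nth_equalityI)
    fix j assume "j < length (first_derivative p)"
    then have j: "j < \<nu>" using len by simp
    \<comment> \<open>Both ends lie outside \<open>entry\<close>: index 0 copies a starred value,
      and the last entry of a codeword is 0.\<close>
    consider "j = 0" | k where "j = Suc k" "k + 3 \<le> \<nu>" | "Suc j = \<nu>"
      using j by (cases j) force+
    then show "first_derivative p ! j = q ! j"
    proof cases
      case 1
      then show ?thesis
        using star[of 0] \<open>\<nu> \<ge> 2\<close> len by (simp add: deriv_entry.simps antideriv_star.simps)
    next
      case 2
      then show ?thesis using entry star j len by simp
    next
      case 3
      then show ?thesis
        using lehmer_codewordsD(2,3)[OF q, of j] len by (simp add: deriv_entry.simps)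
    qed
  qed (simp add: len)
  then show ?thesis by (simp add: p_def)
qed

theorem proposition4:
  fixes \<nu> :: nat
  assumes "\<nu> \<ge> 2"
  shows "bij_betw first_derivative (lehmer_codewords \<nu>) (lehmer_codewords \<nu>) \<and>
    (\<forall>q \<in> lehmer_codewords \<nu>.
       inv_into (lehmer_codewords \<nu>) first_derivative q = antiderivative q)"
proof
  show bij: "bij_betw first_derivative (lehmer_codewords \<nu>) (lehmer_codewords \<nu>)"
    using assms
    by (intro bij_betw_byWitness[where f' = antiderivative])
      (auto simp: antiderivative_first_derivative first_derivative_antiderivative
        first_derivative_in_lehmer_codewords antiderivative_in_lehmer_codewords)
  show "\<forall>q \<in> lehmer_codewords \<nu>.
      inv_into (lehmer_codewords \<nu>) first_derivative q = antiderivative q"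
    \<comment> \<open>By injectivity, the codeword \<open>antiderivative q\<close>, being mapped to
      \<open>q\<close>, is the preimage that \<open>inv_into\<close> picks.\<close>
    using assms bij
    by (auto intro!: inv_into_f_eq simp: bij_betw_imp_inj_on first_derivative_antiderivative
        antiderivative_in_lehmer_codewords)
qed

end
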